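(* Let $\phi=\frac12(1+\sqrt5)$, $F_j$ the Fibonacci numbers ($F_1=F_2=1$), and $G_n(x)=\prod_{i=0}^{n-1}\left(1+x^{\phi^i}\right)$. For $n\ge1$, one can write $G_n(x)=T_1(x)+T_2(x)+\cdots+T_k(x)$, where each $T_i(x)$ has the form $c_1x^{a}+c_2x^{a+1}$ or $c_1x^a+c_2x^{a+1}+c_3x^{a+2}$ for some $a\in\mathbb{Z}[\phi]$ and positive integers $c_1,c_2$ (and $c_3$), and where the largest exponent of a term of $T_i(x)$ is less than the smallest exponent of a term of $T_{i+1}(x)$ for each $i$. Moreover, $k=F_{n+1}$. *)

theory Defs
  imports Complex_Main
    "HOL-Library.Poly_Mapping"
    "HOL-Computational_Algebra.Polynomial"
    "HOL-Number_Theory.Fib"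
begin

definition phi :: real where
  "phi = (1 + sqrt 5) / 2"

definition Z_phi :: "real set" where
  "Z_phi = range (\<lambda>p :: int poly. poly (map_poly of_int p) phi)"

text \<open>
  Finite sums of terms \<open>c x\<^sup>a\<close> with real exponents are elements of the monoid algebra of the
  additive monoid of the reals, i.e. of the type \<open>real \<Rightarrow>\<^sub>0 int\<close>, whose multiplication is convolution.
\<close>

abbreviation xterm :: "int \<Rightarrow> real \<Rightarrow> (real \<Rightarrow>\<^sub>0 int)" where
  "xterm c a \<equiv> Poly_Mapping.single a c"

definition G :: "nat \<Rightarrow> (real \<Rightarrow>\<^sub>0 int)" where
  "G n = (\<Prod>i<n. 1 + xterm 1 (phi ^ i))"

definition block :: "(real \<Rightarrow>\<^sub>0 int) \<Rightarrow> bool" where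
  "block T \<longleftrightarrow>
     (\<exists>a\<in>Z_phi. \<exists>c1 c2. c1 > 0 \<and> c2 > 0 \<and> T = xterm c1 a + xterm c2 (a + 1)) \<or>
     (\<exists>a\<in>Z_phi. \<exists>c1 c2 c3. c1 > 0 \<and> c2 > 0 \<and> c3 > 0 \<and>
        T = xterm c1 a + xterm c2 (a + 1) + xterm c3 (a + 2))"

definition block_decomposition :: "nat \<Rightarrow> (real \<Rightarrow>\<^sub>0 int) list \<Rightarrow> bool" where
  "block_decomposition n Ts \<longleftrightarrow>
     G n = sum_list Ts \<and>
     (\<forall>T\<in>set Ts. block T) \<and>
     (\<forall>i. Suc i < length Ts \<longrightarrow>
        Max (Poly_Mapping.keys (Ts ! i)) < Min (Poly_Mapping.keys (Ts ! Suc i)))"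

lemma phi_squared: "phi * phi = phi + 1"
proof -
  have "sqrt 5 * sqrt 5 = (5 :: real)"
    by simp
  then show ?thesis
    by (simp add: phi_def field_simps)
qed

lemma Z_phi_eq: "Z_phi = {real_of_int a + real_of_int b * phi | a b. True}"
proof (intro equalityI subsetI)
  fix z assume "z \<in> Z_phi"
  then obtain p :: "int poly" where z: "z = poly (map_poly of_int p) phi"
    by (auto simp: Z_phi_def)
  have "\<exists>a b. poly (map_poly of_int p) phi = real_of_int a + real_of_int b * phi"
  proof (induction p)
    case 0
    show ?case
      by (intro exI[of _ 0]) simp
  next
    case (pCons c p)
    then obtain a b where ab: "poly (map_poly of_int p) phi = real_of_int a + real_of_int b * phi"
      by blast
    have "poly (map_poly of_int (pCons c p)) phi
        = real_of_int c + phi * (real_of_int a + real_of_int b * phi)"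
      using pCons.hyps by (simp add: map_poly_pCons ab)
    also have "\<dots> = real_of_int c + real_of_int a * phi + real_of_int b * (phi * phi)"
      by (simp add: algebra_simps)
    also have "\<dots> = real_of_int (c + b) + real_of_int (a + b) * phi"
      by (simp add: phi_squared algebra_simps)
    finally show ?case
      by blast
  qed
  then show "z \<in> {real_of_int a + real_of_int b * phi | a b. True}"
    by (simp add: z)
next
  fix z assume "z \<in> {real_of_int a + real_of_int b * phi | a b. True}"
  then obtain a b where "z = real_of_int a + real_of_int b * phi"
    by blast
  then have "z = poly (map_poly of_int [:a, b:]) phi"
    by (simp add: map_poly_pCons)
  then show "z \<in> Z_phi"
    unfolding Z_phi_def by blast
qed

end

theory Submission
  imports Defs
begin

text \<open>
  An exponent \<open>z = a + b phi\<close> of \<open>G n\<close> is a sum of distinct powers \<open>phi ^ i\<close> with \<open>i < n\<close>, so \<open>b\<close> is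
  a sum of distinct \<open>fib i\<close>, and every \<open>b\<close> from \<open>0\<close> to \<open>fib (n + 1) - 1\<close> occurs. The conjugate
  \<open>a + b (1 - phi)\<close> lies in the open window \<open>(-1, phi)\<close> of length \<open>phi\<^sup>2 < 3\<close>; hence for fixed \<open>b\<close>
  the values of \<open>a\<close> span at most three integers. Adding or removing the power \<open>phi ^ 0 = 1\<close> shows that
  every such \<open>a\<close> has a neighbour, so they form a run of two or three consecutive integers. The window
  also separates the runs for \<open>b\<close> and \<open>b + 1\<close>. Conversely, all exponents of a block share the same
  \<open>b\<close>, and two blocks with the same \<open>b\<close> would need four values of \<open>a\<close>; so in any decomposition the
  blocks correspond to the values of \<open>b\<close>.
\<close>

section \<open>Coordinates in Z[phi]\<close>

definition zphi :: "int \<Rightarrow> int \<Rightarrow> real" where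
  "zphi a b = of_int a + of_int b * phi"

definition line_part :: "nat \<Rightarrow> int \<Rightarrow> int set" where
  "line_part n b = {a. zphi a b \<in> Poly_Mapping.keys (G n)}"

lemma phi_bounds: "1 < phi" "phi < 2"
proof -
  have "sqrt 1 < sqrt 5" "sqrt 5 < sqrt 9"
    by (simp_all only: real_sqrt_less_iff)
  then show "1 < phi" "phi < 2"
    by (simp_all add: phi_def)
qed

lemma phi_irrational: "phi \<notin> \<rat>"
proof
  assume "phi \<in> \<rat>"
  then obtain m k :: nat where k: "k \<noteq> 0" and mk: "\<bar>phi\<bar> = real m / real k" and cop: "coprime m k"
    by (rule Rats_abs_nat_div_natE)
  have "real m = phi * real k"
    using mk phi_bounds k by (simp add: field_simps)
  then have "real m * real m = (phi * phi) * (real k * real k)"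
    "real m * real k + real k * real k = (phi + 1) * (real k * real k)"
    by (simp_all add: algebra_simps)
  then have "real m * real m = real m * real k + real k * real k"
    by (simp only: phi_squared)
  then have eq: "m * m = m * k + k * k"
    by (metis of_nat_add of_nat_eq_iff of_nat_mult)
  \<comment> \<open>Unless \<open>m\<close> and \<open>k\<close> are both even, the two sides of
    \<open>eq\<close> have opposite parity.\<close>
  have "even (m * m) \<longleftrightarrow> even (m * k + k * k)"
    by (simp only: eq)
  then have "even m \<and> even k"
    by auto
  then show False
    using cop by (meson coprime_common_divisor odd_one)
qed

text \<open>By irrationality of \<open>phi\<close>, coordinates are unique; this makes
  \<open>b\<close> a well-defined label of an exponent.\<close>

lemma zphi_eq_iff: "zphi a b = zphi c d \<longleftrightarrow> a = c \<and> b = d"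
proof
  assume eq: "zphi a b = zphi c d"
  have "b = d"
  proof (rule ccontr)
    assume "b \<noteq> d"
    then have "phi = of_int (c - a) / of_int (b - d)"
      using eq by (simp add: zphi_def field_simps)
    then show False
      using phi_irrational by (metis Rats_divide Rats_of_int)
  qed
  with eq show "a = c \<and> b = d"
    by (simp add: zphi_def)
qed simp

lemma zphi_mem: "zphi a b \<in> Z_phi"
  by (auto simp: Z_phi_eq zphi_def)

section \<open>Powers of phi and of its conjugate\<close>

text \<open>Stated for any root of \<open>x * x = x + 1\<close>, so that \<open>phi\<close> and its
  conjugate \<open>1 - phi\<close> get the same integer coordinates. The difference
  \<open>fib (Suc i) - fib i\<close> stands for F_(i-1) and has the right value 1 at
  \<open>i = 0\<close>.\<close>

lemma power_eq_fib:
  fixes x :: real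
  assumes "x * x = x + 1"
  shows "x ^ i = of_int (int (fib (Suc i)) - int (fib i)) + of_int (int (fib i)) * x"
proof (induction i)
  case (Suc i)
  have "x ^ Suc i = x * (of_int (int (fib (Suc i)) - int (fib i)) + of_int (int (fib i)) * x)"
    by (simp only: power_Suc Suc)
  also have "\<dots> = of_int (int (fib (Suc i)) - int (fib i)) * x + of_int (int (fib i)) * (x * x)"
    by (simp add: algebra_simps)
  finally show ?case
    by (simp add: assms algebra_simps)
qed simp

lemma sum_powers_eq_fib:
  fixes x :: real
  assumes "x * x = x + 1"
  shows "(\<Sum>i\<in>J. x ^ i) = of_int (\<Sum>i\<in>J. int (fib (Suc i)) - int (fib i))
            + of_int (\<Sum>i\<in>J. int (fib i)) * x"
  by (simp only: power_eq_fib[OF assms] sum.distrib of_int_sum sum_distrib_right)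

lemma conj_squared: "(1 - phi) * (1 - phi) = (1 - phi) + 1"
  using phi_squared by (simp add: algebra_simps)

text \<open>The map \<open>c \<mapsto> (1 - phi) * c + {0, 1}\<close> preserves the window \<open>(-1, phi)\<close>.\<close>

lemma conj_sum_window:
  "J \<subseteq> {..<n} \<Longrightarrow> -1 < (\<Sum>i\<in>J. (1 - phi) ^ i) \<and> (\<Sum>i\<in>J. (1 - phi) ^ i) < phi"
proof (induction n arbitrary: J)
  case 0
  then show ?case
    using phi_bounds by simp
next
  case (Suc n)
  define K where "K = {i. Suc i \<in> J}"
  define c where "c = (\<Sum>i\<in>K. (1 - phi) ^ i)"
  have K: "K \<subseteq> {..<n}"
    using Suc.prems by (auto simp: K_def)
  then have fin: "finite K"
    by (rule finite_subset) simp
  have c: "-1 < c" "c < phi"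
    using Suc.IH[OF K] by (simp_all add: c_def)
  have J: "J = (if 0 \<in> J then {0} else {}) \<union> Suc ` K"
  proof (intro equalityI subsetI)
    fix i assume "i \<in> J"
    then show "i \<in> (if 0 \<in> J then {0} else {}) \<union> Suc ` K"
      by (cases i) (auto simp: K_def)
  qed (auto simp: K_def split: if_splits)
  have "(\<Sum>i\<in>J. (1 - phi) ^ i)
      = (if 0 \<in> J then 1 else 0) + (\<Sum>i\<in>Suc ` K. (1 - phi) ^ i)"
    by (subst J, subst sum.union_disjoint) (auto simp: fin)
  also have "(\<Sum>i\<in>Suc ` K. (1 - phi) ^ i) = (1 - phi) * c"
    by (simp add: sum.reindex c_def sum_distrib_left)
  finally have eq: "(\<Sum>i\<in>J. (1 - phi) ^ i) = (if 0 \<in> J then 1 else 0) + (1 - phi) * c" .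
  \<comment> \<open>Since \<open>(phi - 1) * phi = 1\<close>, the product
    \<open>(1 - phi) * c\<close> lies in \<open>(-1, phi - 1)\<close>, which leaves room to add
    1.\<close>
  have "(phi - 1) * c < (phi - 1) * phi" "(phi - 1) * (-1) < (phi - 1) * c"
    using c phi_bounds by (simp_all only: mult_less_cancel_left_pos diff_gt_0_iff_gt)
  then have "-1 < (1 - phi) * c" "(1 - phi) * c < phi - 1"
    using phi_squared by (simp_all add: algebra_simps)
  then show ?case
    using phi_bounds by (simp add: eq)
qed

section \<open>Exponents of G as subset sums\<close>

lemma prod_xterm:
  assumes "finite J"
  shows "(\<Prod>i\<in>J. xterm 1 (f i)) = xterm 1 (\<Sum>i\<in>J. f i)"
  using assms by (induction J) (simp_all add: mult_single)

lemma G_expansion: "G n = (\<Sum>J\<in>Pow {..<n}. xterm 1 (\<Sum>i\<in>J. phi ^ i))"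
proof -
  have "G n = (\<Prod>i<n. xterm 1 (phi ^ i) + 1)"
    by (simp add: G_def add.commute)
  also have "\<dots> = (\<Sum>J\<in>Pow {..<n}. \<Prod>i\<in>J. xterm 1 (phi ^ i))"
    by (simp add: prod_add)
  also have "\<dots> = (\<Sum>J\<in>Pow {..<n}. xterm 1 (\<Sum>i\<in>J. phi ^ i))"
    by (intro sum.cong refl prod_xterm) (auto intro: finite_subset)
  finally show ?thesis .
qed

lemma lookup_G:
  "Poly_Mapping.lookup (G n) z = int (card {J \<in> Pow {..<n}. (\<Sum>i\<in>J. phi ^ i) = z})"
  by (simp add: G_expansion lookup_sum lookup_single when_def sum.If_cases Int_def eq_commute[of z])

text \<open>Nothing cancels: a coefficient counts the subsets with the given sum, so a single such
  subset makes it nonzero.\<close>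

lemma keys_G: "Poly_Mapping.keys (G n) = (\<lambda>J. \<Sum>i\<in>J. phi ^ i) ` Pow {..<n}"
proof -
  have "z \<in> Poly_Mapping.keys (G n) \<longleftrightarrow> {J \<in> Pow {..<n}. (\<Sum>i\<in>J. phi ^ i) = z} \<noteq> {}" for z
    by (simp only: in_keys_iff lookup_G of_nat_eq_0_iff card_eq_0_iff) simp
  then show ?thesis
    by (auto simp: set_eq_iff image_iff eq_commute)
qed

lemma keys_G_cases:
  assumes "z \<in> Poly_Mapping.keys (G n)"
  obtains J where "J \<subseteq> {..<n}" "z = (\<Sum>i\<in>J. phi ^ i)"
    "z = zphi (\<Sum>i\<in>J. int (fib (Suc i)) - int (fib i)) (\<Sum>i\<in>J. int (fib i))"
proof -
  from assms obtain J where J: "J \<subseteq> {..<n}" "z = (\<Sum>i\<in>J. phi ^ i)"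
    by (auto simp: keys_G)
  moreover have "z = zphi (\<Sum>i\<in>J. int (fib (Suc i)) - int (fib i)) (\<Sum>i\<in>J. int (fib i))"
    unfolding zphi_def J(2) by (rule sum_powers_eq_fib[OF phi_squared])
  ultimately show thesis
    by (rule that)
qed

lemma sum_fib: "(\<Sum>i<n. int (fib i)) = int (fib (Suc n)) - 1"
  by (induction n) simp_all

lemma keys_G_range:
  assumes "z \<in> Poly_Mapping.keys (G n)"
  shows "\<exists>a b. z = zphi a b \<and> 0 \<le> b \<and> b < int (fib (Suc n))"
proof -
  obtain J where J: "J \<subseteq> {..<n}"
    "z = zphi (\<Sum>i\<in>J. int (fib (Suc i)) - int (fib i)) (\<Sum>i\<in>J. int (fib i))"
    using assms by (rule keys_G_cases)
  have "(\<Sum>i\<in>J. int (fib i)) \<le> (\<Sum>i<n. int (fib i))"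
    using J(1) by (intro sum_mono2) auto
  then have "(\<Sum>i\<in>J. int (fib i)) < int (fib (Suc n))"
    by (simp add: sum_fib)
  moreover have "0 \<le> (\<Sum>i\<in>J. int (fib i))"
    by (intro sum_nonneg) simp
  ultimately show ?thesis
    using J(2) by blast
qed

section \<open>Exponents with a fixed coefficient of phi\<close>

text \<open>Uniqueness of coordinates lets the index set \<open>J\<close> of an exponent also
  express the conjugate as a sum of powers of \<open>1 - phi\<close>, to which
  \<open>conj_sum_window\<close> applies.\<close>

lemma line_part_window:
  assumes "a \<in> line_part n b"
  shows "-1 < of_int a + of_int b * (1 - phi)" "of_int a + of_int b * (1 - phi) < phi"
proof -
  obtain J where J: "J \<subseteq> {..<n}"
    "zphi a b = zphi (\<Sum>i\<in>J. int (fib (Suc i)) - int (fib i)) (\<Sum>i\<in>J. int (fib i))"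
    using assms unfolding line_part_def by (auto elim: keys_G_cases)
  then have "of_int a + of_int b * (1 - phi) = (\<Sum>i\<in>J. (1 - phi) ^ i)"
    unfolding zphi_eq_iff by (simp only: sum_powers_eq_fib[OF conj_squared])
  then show "-1 < of_int a + of_int b * (1 - phi)" "of_int a + of_int b * (1 - phi) < phi"
    using conj_sum_window[OF J(1)] by simp_all
qed

lemma line_part_neighbour:
  assumes "a \<in> line_part n b" "n \<ge> 1"
  shows "a + 1 \<in> line_part n b \<or> a - 1 \<in> line_part n b"
proof -
  obtain J where J: "J \<subseteq> {..<n}" "zphi a b = (\<Sum>i\<in>J. phi ^ i)"
    using assms unfolding line_part_def by (auto elim: keys_G_cases)
  have fin: "finite J"
    using J(1) by (rule finite_subset) simp
  show ?thesis
  proof (cases "0 \<in> J")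
    case True
    have "zphi (a - 1) b = (\<Sum>i\<in>J - {0}. phi ^ i)"
      using True fin J(2) by (simp add: sum_diff1 zphi_def)
    moreover have "J - {0} \<in> Pow {..<n}"
      using J(1) by auto
    ultimately show ?thesis
      unfolding line_part_def keys_G by blast
  next
    case False
    have "zphi (a + 1) b = (\<Sum>i\<in>insert 0 J. phi ^ i)"
      using False fin J(2) by (simp add: zphi_def)
    moreover have "insert 0 J \<in> Pow {..<n}"
      using J(1) assms(2) by auto
    ultimately show ?thesis
      unfolding line_part_def keys_G by blast
  qed
qed

lemma fib_subset_sum:
  "b < fib (Suc n) \<Longrightarrow> \<exists>J. J \<subseteq> {..<n} \<and> (\<Sum>i\<in>J. fib i) = b"
proof (induction n arbitrary: b)
  case 0
  then show ?case
    by auto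
next
  case (Suc n)
  show ?case
  proof (cases "b < fib (Suc n)")
    case True
    with Suc.IH obtain J where "J \<subseteq> {..<n}" "(\<Sum>i\<in>J. fib i) = b"
      by blast
    then show ?thesis
      by (auto intro!: exI[of _ J])
  next
    \<comment> \<open>Here \<open>b\<close> is at least F_(n+1), hence at least F_n, and
      \<open>b\<close> < F_(n+2) = F_(n+1) + F_n. Using index \<open>n\<close> thus leaves a
      remainder below F_(n+1) for the indices below \<open>n\<close>.\<close>
    case False
    then have ge: "fib n \<le> b" and "b - fib n < fib (Suc n)"
      using Suc.prems fib_Suc_mono[of n] by simp_all
    then obtain J where J: "J \<subseteq> {..<n}" "(\<Sum>i\<in>J. fib i) = b - fib n"
      using Suc.IH by blast
    have "finite J" "n \<notin> J"
      using J(1) finite_subset by auto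
    then have "(\<Sum>i\<in>insert n J. fib i) = b"
      using J(2) ge by simp
    moreover have "insert n J \<subseteq> {..<Suc n}"
      using J(1) by auto
    ultimately show ?thesis
      by blast
  qed
qed

lemma line_part_nonempty:
  assumes "0 \<le> b" "b < int (fib (Suc n))"
  shows "line_part n b \<noteq> {}"
proof -
  obtain J where J: "J \<subseteq> {..<n}" "(\<Sum>i\<in>J. fib i) = nat b"
    using fib_subset_sum[of "nat b" n] assms nat_less_iff by blast
  have "(\<Sum>i\<in>J. int (fib i)) = b"
    using J(2) assms(1) by (simp flip: of_nat_sum)
  then have "(\<Sum>i\<in>J. phi ^ i) = zphi (\<Sum>i\<in>J. int (fib (Suc i)) - int (fib i)) b"
    using sum_powers_eq_fib[OF phi_squared, of J] by (simp only: zphi_def)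
  then show ?thesis
    using J(1) unfolding line_part_def keys_G by (metis PowI empty_Collect_eq imageI)
qed

lemma line_part_span:
  assumes "a \<in> line_part n b" "c \<in> line_part n b"
  shows "c \<le> a + 2"
proof -
  \<comment> \<open>The shared term \<open>of_int b * (1 - phi)\<close> cancels, leaving the window
    length \<open>phi + 1\<close>, which is below 3.\<close>
  have "of_int c - of_int a < phi + 1"
    using line_part_window[OF assms(1)] line_part_window[OF assms(2)] by linarith
  then show ?thesis
    using phi_bounds by linarith
qed

lemma finite_line_part: "finite (line_part n b)"
proof (cases "line_part n b = {}")
  case False
  then obtain a where a: "a \<in> line_part n b"
    by blast
  have "line_part n b \<subseteq> {a - 2..a + 2}"
    using line_part_span[OF a] line_part_span[OF _ a] by fastforce
  then show ?thesis
    by (rule finite_subset) simp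
qed simp

lemma line_part_shape:
  assumes "n \<ge> 1" "0 \<le> b" "b < int (fib (Suc n))"
  obtains m where "line_part n b = {m, m + 1} \<or> line_part n b = {m, m + 1, m + 2}"
proof -
  define m where "m = Min (line_part n b)"
  have ne: "line_part n b \<noteq> {}"
    using assms by (intro line_part_nonempty)
  have m: "m \<in> line_part n b"
    using finite_line_part ne by (simp add: m_def)
  have le: "m \<le> a" if "a \<in> line_part n b" for a
    using finite_line_part that by (simp add: m_def)
  \<comment> \<open>By minimality \<open>m - 1\<close> is absent, so the neighbour of
    \<open>m\<close> must be \<open>m + 1\<close>.\<close>
  have m1: "m + 1 \<in> line_part n b"
    using line_part_neighbour[OF m assms(1)] le[of "m - 1"] by auto
  have "a \<in> {m, m + 1, m + 2}" if "a \<in> line_part n b" for a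
    using le[OF that] line_part_span[OF m that] by force
  then have "line_part n b \<subseteq> {m, m + 1, m + 2}"
    by blast
  with m m1 show thesis
    by (intro that[of m]) blast
qed

text \<open>
  With difference \<open>k + phi\<close> between the two exponents, \<open>k \<le> -2\<close> would make the conjugates differ
  by at least \<open>phi\<^sup>2\<close>, the length of the open window.
\<close>

lemma zphi_less_next_line:
  assumes "a \<in> line_part n b" "c \<in> line_part n (b + 1)"
  shows "zphi a b < zphi c (b + 1)"
proof -
  have "of_int a - of_int c < (2 :: real)"
    using line_part_window[OF assms(1)] line_part_window[OF assms(2)]
    by (simp add: algebra_simps)
  then have "a \<le> c + 1"
    by linarith
  then have "real_of_int a \<le> of_int c + 1"
    by linarith
  then show ?thesis
    using phi_bounds by (simp add: zphi_def algebra_simps)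
qed

section \<open>Grouping G by the coefficient of phi\<close>

definition line_block :: "nat \<Rightarrow> int \<Rightarrow> (real \<Rightarrow>\<^sub>0 int)" where
  "line_block n b = (\<Sum>a\<in>line_part n b. xterm (Poly_Mapping.lookup (G n) (zphi a b)) (zphi a b))"

lemma lookup_G_pos:
  assumes "a \<in> line_part n b"
  shows "Poly_Mapping.lookup (G n) (zphi a b) > 0"
proof -
  have "Poly_Mapping.lookup (G n) (zphi a b) \<noteq> 0"
    using assms by (simp add: line_part_def in_keys_iff)
  moreover have "Poly_Mapping.lookup (G n) (zphi a b) \<ge> 0"
    by (simp only: lookup_G of_nat_0_le_iff)
  ultimately show ?thesis
    by simp
qed

lemma keys_line_block: "Poly_Mapping.keys (line_block n b) \<subseteq> (\<lambda>a. zphi a b) ` line_part n b"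
  unfolding line_block_def by (rule order_trans[OF keys_sum]) auto

lemma block_line_block:
  assumes "n \<ge> 1" "0 \<le> b" "b < int (fib (Suc n))"
  shows "block (line_block n b)"
proof -
  obtain m where m: "line_part n b = {m, m + 1} \<or> line_part n b = {m, m + 1, m + 2}"
    using assms by (rule line_part_shape)
  define c where "c = (\<lambda>a. Poly_Mapping.lookup (G n) (zphi a b))"
  have pos: "c a > 0" if "a \<in> line_part n b" for a
    using lookup_G_pos[OF that] by (simp add: c_def)
  have shift: "zphi (m + 1) b = zphi m b + 1" "zphi (m + 2) b = zphi m b + 2"
    by (simp_all add: zphi_def)
  from m show ?thesis
  proof
    assume A: "line_part n b = {m, m + 1}"
    have "line_block n b = xterm (c m) (zphi m b) + xterm (c (m + 1)) (zphi m b + 1)"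
      by (simp add: line_block_def A c_def shift)
    moreover have "c m > 0" "c (m + 1) > 0"
      using pos A by auto
    ultimately show ?thesis
      unfolding block_def using zphi_mem by blast
  next
    assume A: "line_part n b = {m, m + 1, m + 2}"
    have "line_block n b = xterm (c m) (zphi m b) + xterm (c (m + 1)) (zphi m b + 1)
        + xterm (c (m + 2)) (zphi m b + 2)"
      by (simp add: line_block_def A c_def shift add.assoc)
    moreover have "c m > 0" "c (m + 1) > 0" "c (m + 2) > 0"
      using pos A by auto
    ultimately show ?thesis
      unfolding block_def using zphi_mem by blast
  qed
qed

lemma G_eq_sum_line_blocks: "G n = (\<Sum>b = 0..<int (fib (Suc n)). line_block n b)"
proof (rule poly_mapping_eqI)
  fix z
  let ?B = "{0..<int (fib (Suc n))}"
  \<comment> \<open>Unique coordinates keep \<open>zphi a b\<close> out of every other line. The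
    formula also covers \<open>a\<close> outside \<open>line_part n d\<close>: for
    \<open>b = d\<close> the coefficient in \<open>G n\<close> is then 0.\<close>
  have line: "Poly_Mapping.lookup (line_block n d) (zphi a b)
      = (if b = d then Poly_Mapping.lookup (G n) (zphi a b) else 0)" for a b d
  proof -
    have "Poly_Mapping.lookup (line_block n d) (zphi a b)
        = (\<Sum>e\<in>line_part n d. if e = a then (if b = d then Poly_Mapping.lookup (G n) (zphi a b) else 0) else 0)"
      unfolding line_block_def lookup_sum
      by (intro sum.cong refl) (auto simp: lookup_single when_def zphi_eq_iff)
    also have "\<dots> = (if b = d then Poly_Mapping.lookup (G n) (zphi a b) else 0)"
      using finite_line_part by (auto simp: sum.delta' line_part_def in_keys_iff)
    finally show ?thesis .
  qed
  show "Poly_Mapping.lookup (G n) z = Poly_Mapping.lookup (\<Sum>b\<in>?B. line_block n b) z"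
  proof (cases "z \<in> Poly_Mapping.keys (G n)")
    case True
    then obtain a b where z: "z = zphi a b" "b \<in> ?B"
      using keys_G_range by fastforce
    then show ?thesis
      by (simp add: lookup_sum line)
  next
    case False
    then have "z \<notin> Poly_Mapping.keys (line_block n b)" for b
      using keys_line_block by (force simp: line_part_def)
    then have "Poly_Mapping.lookup (line_block n b) z = 0" for b
      by (simp add: in_keys_iff)
    then show ?thesis
      using False by (simp add: lookup_sum in_keys_iff)
  qed
qed

section \<open>Supports of arbitrary blocks and their sums\<close>

lemma block_cases:
  assumes "block T"
  obtains b where "Poly_Mapping.keys T \<subseteq> range (\<lambda>a. zphi a b)" "card (Poly_Mapping.keys T) \<ge> 2"
    "\<And>z. Poly_Mapping.lookup T z \<ge> 0"
proof -
  \<comment> \<open>Allowing \<open>c3 = 0\<close> merges the two-term form into the three-term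
    form.\<close>
  from assms obtain z c1 c2 c3 where z: "z \<in> Z_phi" and c: "c1 > 0" "c2 > 0" "c3 \<ge> 0"
    and T: "T = xterm c1 z + xterm c2 (z + 1) + xterm c3 (z + 2)"
    unfolding block_def by (metis add.right_neutral less_imp_le order_refl single_zero)
  obtain a b where ab: "z = zphi a b"
    using z by (auto simp: Z_phi_eq zphi_def)
  have shift: "z + 1 = zphi (a + 1) b" "z + 2 = zphi (a + 2) b"
    by (simp_all add: ab zphi_def)
  have nonneg: "Poly_Mapping.lookup T x \<ge> 0" for x
    using c by (simp add: T lookup_add lookup_single when_def)
  have "Poly_Mapping.keys T \<subseteq> {z, z + 1, z + 2}"
    by (auto simp: T in_keys_iff lookup_add lookup_single when_def split: if_splits)
  then have keys: "Poly_Mapping.keys T \<subseteq> range (\<lambda>a. zphi a b)"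
    using shift ab by auto
  have "{z, z + 1} \<subseteq> Poly_Mapping.keys T"
    using c by (auto simp: T in_keys_iff lookup_add lookup_single when_def)
  from card_mono[OF _ this] have "card (Poly_Mapping.keys T) \<ge> 2"
    by simp
  with keys nonneg show thesis
    by (intro that)
qed

lemma keys_sum_list_nonneg:
  fixes Ts :: "('a \<Rightarrow>\<^sub>0 int) list"
  assumes "\<And>T z. T \<in> set Ts \<Longrightarrow> Poly_Mapping.lookup T z \<ge> 0"
  shows "Poly_Mapping.keys (sum_list Ts) = (\<Union>T\<in>set Ts. Poly_Mapping.keys T)"
proof -
  \<comment> \<open>Nonnegativity of the partial sum is carried through the induction, because it
    rules out cancellation when the next summand is added.\<close>
  have "(\<forall>z. Poly_Mapping.lookup (sum_list Ts) z \<ge> 0) \<and>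
      Poly_Mapping.keys (sum_list Ts) = (\<Union>T\<in>set Ts. Poly_Mapping.keys T)"
    using assms
  proof (induction Ts)
    case (Cons T Ts)
    have "Poly_Mapping.lookup T z \<ge> 0" "Poly_Mapping.lookup (sum_list Ts) z \<ge> 0" for z
      using Cons by auto
    moreover from this have "Poly_Mapping.keys (T + sum_list Ts)
        = Poly_Mapping.keys T \<union> Poly_Mapping.keys (sum_list Ts)"
      by (auto simp: in_keys_iff lookup_add add_nonneg_eq_0_iff)
    ultimately show ?case
      using Cons by (simp add: lookup_add)
  qed simp
  then show ?thesis
    by blast
qed

lemma disjoint_if_consecutive_Max_less_Min:
  fixes Ks :: "'a :: linorder set list"
  assumes "\<And>K. K \<in> set Ks \<Longrightarrow> finite K \<and> K \<noteq> {}"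
    and "\<And>i. Suc i < length Ks \<Longrightarrow> Max (Ks ! i) < Min (Ks ! Suc i)"
    and "i < length Ks" "j < length Ks" "i \<noteq> j"
  shows "Ks ! i \<inter> Ks ! j = {}"
proof -
  \<comment> \<open>Finiteness and nonemptiness are built into \<open>R\<close> for transitivity:
    the chain Max A < Min B \<le> Max B < Min C needs its middle link. Transitivity then extends the
    separation from consecutive sets to all pairs.\<close>
  define R where "R = (\<lambda>A B :: 'a set. finite A \<and> finite B \<and> A \<noteq> {} \<and> B \<noteq> {} \<and> Max A < Min B)"
  have "transp R"
  proof (rule transpI)
    fix A B C assume *: "R A B" "R B C"
    then have "Min B \<le> Max B"
      by (simp add: R_def)
    with * show "R A C"
      unfolding R_def by (meson less_le_trans less_trans)
  qed
  moreover have "R (Ks ! i) (Ks ! Suc i)" if "Suc i < length Ks" for i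
    unfolding R_def
    using assms(1)[of "Ks ! i"] assms(1)[of "Ks ! Suc i"] assms(2)[OF that] that nth_mem Suc_lessD
    by blast
  ultimately have "sorted_wrt R Ks"
    by (simp add: sorted_wrt_iff_nth_Suc_transp)
  then have "R (Ks ! i) (Ks ! j) \<or> R (Ks ! j) (Ks ! i)"
    using assms(3-5) by (metis linorder_neqE_nat sorted_wrt_nth_less)
  moreover have "A \<inter> B = {}" if "R A B" for A B
    using that unfolding R_def by (meson Max_ge Min_le disjoint_iff leD le_less_trans order_trans)
  ultimately show ?thesis
    by blast
qed

section \<open>Existence of a decomposition and the number of blocks\<close>

lemma block_decomposition_exists:
  assumes "n \<ge> 1"
  shows "block_decomposition n (map (\<lambda>k. line_block n (int k)) [0..<fib (n + 1)])"
proof -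
  let ?Ts = "map (\<lambda>k. line_block n (int k)) [0..<fib (n + 1)]"
  have "sum_list ?Ts = (\<Sum>k = 0..<fib (n + 1). line_block n (int k))"
    by (simp only: interv_sum_list_conv_sum_set_nat set_upt)
  also have "\<dots> = (\<Sum>b\<in>int ` {0..<fib (n + 1)}. line_block n b)"
    by (simp add: sum.reindex)
  also have "\<dots> = G n"
    by (simp add: image_int_atLeastLessThan G_eq_sum_line_blocks)
  finally have "G n = sum_list ?Ts" ..
  moreover have blocks: "block (line_block n (int k))" if "k < fib (n + 1)" for k
    using that assms by (intro block_line_block) simp_all
  moreover have "Max (Poly_Mapping.keys (?Ts ! i)) < Min (Poly_Mapping.keys (?Ts ! Suc i))"
    if i: "Suc i < length ?Ts" for i
  proof -
    \<comment> \<open>Nonempty supports let the comparison of \<open>Max\<close> and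
      \<open>Min\<close> reduce to comparing elements.\<close>
    have ne: "Poly_Mapping.keys (line_block n (int k)) \<noteq> {}" if "k < fib (n + 1)" for k
      using blocks[OF that] by (metis block_cases card.empty not_numeral_le_zero)
    have "x < y" if x: "x \<in> Poly_Mapping.keys (line_block n (int i))"
      and y: "y \<in> Poly_Mapping.keys (line_block n (int (Suc i)))" for x y
    proof -
      have "y \<in> Poly_Mapping.keys (line_block n (int i + 1))"
        using y by (simp add: add.commute)
      then show ?thesis
        using subsetD[OF keys_line_block x] keys_line_block zphi_less_next_line by blast
    qed
    then show ?thesis
      using i ne[of i] ne[of "Suc i"] by (simp del: fib.simps upt_Suc)
  qed
  ultimately show ?thesis
    unfolding block_decomposition_def by auto
qed

text \<open>Sending a position in \<open>Ts\<close> to the common coefficient of \<open>phi\<close>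
  in its block is a bijection onto \<open>{0..<int (fib (n + 1))}\<close>.\<close>

lemma block_decomposition_length:
  assumes "n \<ge> 1" "block_decomposition n Ts"
  shows "length Ts = fib (n + 1)"
proof -
  let ?K = "\<lambda>i. Poly_Mapping.keys (Ts ! i)"
  have G: "G n = sum_list Ts" and blocks: "\<And>T. T \<in> set Ts \<Longrightarrow> block T"
    and sep: "\<And>i. Suc i < length Ts \<Longrightarrow> Max (?K i) < Min (?K (Suc i))"
    using assms(2) by (auto simp: block_decomposition_def)
  have nonneg: "Poly_Mapping.lookup T z \<ge> 0" if "T \<in> set Ts" for T z
    using blocks[OF that] by (rule block_cases)
  have card2: "card (Poly_Mapping.keys T) \<ge> 2" if "T \<in> set Ts" for T
    using blocks[OF that] by (rule block_cases)
  have keys: "Poly_Mapping.keys (G n) = (\<Union>T\<in>set Ts. Poly_Mapping.keys T)"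
    unfolding G by (intro keys_sum_list_nonneg nonneg)
  have disj: "?K i \<inter> ?K j = {}" if "i < length Ts" "j < length Ts" "i \<noteq> j" for i j
  proof -
    have "finite K \<and> K \<noteq> {}" if "K \<in> set (map Poly_Mapping.keys Ts)" for K
      using card2 that by fastforce
    then have "map Poly_Mapping.keys Ts ! i \<inter> map Poly_Mapping.keys Ts ! j = {}"
      by (rule disjoint_if_consecutive_Max_less_Min) (use sep that in simp_all)
    then show ?thesis
      using that by simp
  qed
  have "\<forall>T\<in>set Ts. \<exists>b. Poly_Mapping.keys T \<subseteq> range (\<lambda>a. zphi a b)"
    using blocks by (metis block_cases)
  then obtain \<beta> where \<beta>: "\<And>T. T \<in> set Ts \<Longrightarrow> Poly_Mapping.keys T \<subseteq> range (\<lambda>a. zphi a (\<beta> T))"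
    by metis
  \<comment> \<open>Without cancellation, every exponent of a block is an exponent of
    \<open>G n\<close>, so it lies in the corresponding \<open>line_part\<close>.\<close>
  have on_line: "?K i \<subseteq> (\<lambda>a. zphi a (\<beta> (Ts ! i))) ` line_part n (\<beta> (Ts ! i))"
    if "i < length Ts" for i
    using \<beta>[of "Ts ! i"] that keys by (fastforce simp: line_part_def)
  have range: "\<beta> (Ts ! i) \<in> {0..<int (fib (n + 1))}" if i: "i < length Ts" for i
  proof -
    from card2[of "Ts ! i"] i obtain z where z: "z \<in> ?K i"
      by fastforce
    then obtain a where "z = zphi a (\<beta> (Ts ! i))"
      using on_line[OF i] by blast
    moreover have "z \<in> Poly_Mapping.keys (G n)"
      using keys z i by auto
    ultimately show ?thesis
      using keys_G_range[of z n] by (auto simp: zphi_eq_iff)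
  qed
  have "inj_on (\<lambda>i. \<beta> (Ts ! i)) {..<length Ts}"
  proof (rule inj_onI, rule ccontr)
    fix i j assume i: "i \<in> {..<length Ts}" and j: "j \<in> {..<length Ts}"
      and eq: "\<beta> (Ts ! i) = \<beta> (Ts ! j)" and "i \<noteq> j"
    let ?b = "\<beta> (Ts ! j)"
    \<comment> \<open>Disjoint supports of size at least 2 would put four exponents on a line that
      holds at most three.\<close>
    have "4 \<le> card (?K i \<union> ?K j)"
      using card2[of "Ts ! i"] card2[of "Ts ! j"] disj[of i j] i j \<open>i \<noteq> j\<close>
      by (simp add: card_Un_disjoint)
    also have "\<dots> \<le> card ((\<lambda>a. zphi a ?b) ` line_part n ?b)"
      using on_line[of i] on_line[of j] i j eq finite_line_part by (intro card_mono) auto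
    also have "\<dots> \<le> card (line_part n ?b)"
      using finite_line_part by (rule card_image_le)
    also have "\<dots> \<le> 3"
    proof -
      have "0 \<le> ?b" "?b < int (fib (Suc n))"
        using range[of j] j by simp_all
      then obtain m where "line_part n ?b = {m, m + 1} \<or> line_part n ?b = {m, m + 1, m + 2}"
        using assms(1) line_part_shape by metis
      then show ?thesis
        by auto
    qed
    finally show False
      by simp
  qed
  moreover have "(\<lambda>i. \<beta> (Ts ! i)) ` {..<length Ts} = {0..<int (fib (n + 1))}"
  proof (intro equalityI subsetI)
    \<comment> \<open>Surjectivity: line \<open>b\<close> contains an exponent of
      \<open>G n\<close>, and the block containing it must have label \<open>b\<close>.\<close>
    fix b assume b: "b \<in> {0..<int (fib (n + 1))}"
    then obtain a where "a \<in> line_part n b"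
      using line_part_nonempty[of b n] by auto
    then obtain i where i: "i < length Ts" "zphi a b \<in> ?K i"
      using keys by (auto simp: line_part_def in_set_conv_nth)
    then have "\<beta> (Ts ! i) = b"
      using on_line[of i] by (auto simp: zphi_eq_iff)
    then show "b \<in> (\<lambda>i. \<beta> (Ts ! i)) ` {..<length Ts}"
      using i(1) by blast
  qed (use range in auto)
  ultimately have "card {..<length Ts} = card {0..<int (fib (n + 1))}"
    by (metis card_image)
  then show ?thesis
    by simp
qed

theorem theorem2:
  fixes n :: nat
  assumes "n \<ge> 1"
  shows "(\<exists>Ts. block_decomposition n Ts) \<and>
         (\<forall>Ts. block_decomposition n Ts \<longrightarrow> length Ts = fib (n + 1))"
  using block_decomposition_exists[OF assms] block_decomposition_length[OF assms] by blast

end
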